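(* For any $n\ge 2$, the zeroth Poisson cohomology $PH^0(\mathbb{C}[\mathrm{iss}_n(\mathbb{C}\langle x,x^*\rangle)])$ is infinite dimensional.
   Context: Let $A=\mathbb{C}\langle x,x^*\rangle$. $\mathrm{rep}_n(A)=M_n(\mathbb{C})^{\oplus2}$ with $\mathrm{GL}_n(\mathbb{C})$ acting by simultaneous conjugation, and $\mathrm{iss}_n(A)$ is the quotient variety with coordinate ring $\mathbb{C}[\mathrm{iss}_n(A)]=\mathbb{C}[\mathrm{rep}_n(A)]^{\mathrm{GL}_n(\mathbb{C})}$, which is generated by the functions $tr(w)$, for $w$ a word in $x,x^*$ (trace of $w$ evaluated on the two generic $n\times n$ matrices). The canonical symplectic double bracket on $A$ is the bilinear map $\{\!\{-,-\}\!\}:A\otimes A\to A\otimes A$ determined by $\{\!\{x,x\}\!\}=\{\!\{x^*,x^*\}\!\}=0$, $\{\!\{x,x^*\}\!\}=1\otimes1$, together with $\{\!\{a,b\}\!\}=-\{\!\{b,a\}\!\}^{o}$ (where $(u\otimes v)^o=v\otimes u$) and $\{\!\{a,bc\}\!\}=b\{\!\{a,c\}\!\}+\{\!\{a,b\}\!\}c$ for the outer bimodule structure $a(u\otimes v)c=(au)\otimes(vc)$. With $\mu$ the multiplication of $A$, the map $(a,b)\mapsto\mu(\{\!\{a,b\}\!\})$ induces a Lie bracket $\{-,-\}$ on $\mathfrak{n}=A/[A,A]$ ($[A,A]$ = span of commutators). The Lie-Poisson structure on $S(\mathfrak{n})$ induces, via the surjection $S(\mathfrak{n})\to\mathbb{C}[\mathrm{iss}_n(A)]$,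 $w\mapsto tr(w)$ (whose kernel is a Poisson ideal), a Poisson bracket on $\mathbb{C}[\mathrm{iss}_n(A)]$, characterized by $\{tr(w_1),tr(w_2)\}=tr(\{w_1,w_2\})$. The zeroth Poisson cohomology $PH^0$ of a Poisson algebra is its Poisson center $\{f\mid\{f,g\}=0\ \forall g\}$. *)

theory Defs
  imports "HOL-Analysis.Analysis" "HOL-Library.Poly_Mapping" "HOL-Library.Function_Algebras"
begin

section \<open>The free algebra on two generators\<close>

datatype gen = X | Xstar

datatype word = Word (letters: "gen list")

text \<open>The free monoid is written additively, because the convolution product of
  \<^type>\<open>poly_mapping\<close> is defined over additive monoids.\<close>

instantiation word :: monoid_add
begin
definition "0 = Word []"
definition "u + v = Word (letters u @ letters v)"
instance
  by standard (simp_all add: plus_word_def zero_word_def)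
end

text \<open>\<open>falg\<close> is the free algebra \<open>A\<close>, as the monoid algebra of the free monoid; \<open>falg2\<close> is
  \<open>A \<otimes> A\<close>, where the pair \<open>(u, v)\<close> of words stands for the basis tensor \<open>u \<otimes> v\<close>.\<close>

type_synonym falg = "word \<Rightarrow>\<^sub>0 complex"
type_synonym falg2 = "(word \<times> word) \<Rightarrow>\<^sub>0 complex"

abbreviation scal :: "complex \<Rightarrow> ('m::monoid_add \<Rightarrow>\<^sub>0 complex) \<Rightarrow> ('m \<Rightarrow>\<^sub>0 complex)" (infixr "\<cdot>" 75)
  where "c \<cdot> a \<equiv> Poly_Mapping.single 0 c * a"

abbreviation basis :: "'k \<Rightarrow> ('k \<Rightarrow>\<^sub>0 complex)"
  where "basis k \<equiv> Poly_Mapping.single k 1"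

text \<open>Linear extension of a map given on basis elements.\<close>

definition lin :: "('k \<Rightarrow> ('m::monoid_add \<Rightarrow>\<^sub>0 complex)) \<Rightarrow> ('k \<Rightarrow>\<^sub>0 complex) \<Rightarrow> ('m \<Rightarrow>\<^sub>0 complex)"
  where "lin h a = (\<Sum>k\<in>Poly_Mapping.keys a. Poly_Mapping.lookup a k \<cdot> h k)"

lemma lin_superset:
  assumes "finite K" "Poly_Mapping.keys a \<subseteq> K"
  shows "lin h a = (\<Sum>k\<in>K. Poly_Mapping.lookup a k \<cdot> h k)"
  unfolding lin_def using assms
  by (intro sum.mono_neutral_left) (auto simp: in_keys_iff)

lemma lin_add: "lin h (a + b) = lin h a + lin h b"
proof -
  let ?K = "Poly_Mapping.keys a \<union> Poly_Mapping.keys b"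
  have "lin h (a + b) = (\<Sum>k\<in>?K. Poly_Mapping.lookup (a + b) k \<cdot> h k)"
    by (rule lin_superset) (use Poly_Mapping.keys_add[of a b] in auto)
  also have "\<dots> = (\<Sum>k\<in>?K. Poly_Mapping.lookup a k \<cdot> h k) + (\<Sum>k\<in>?K. Poly_Mapping.lookup b k \<cdot> h k)"
    by (simp add: lookup_add single_add distrib_right sum.distrib)
  also have "\<dots> = lin h a + lin h b"
    by (simp add: lin_superset[of ?K])
  finally show ?thesis .
qed

lemma lin_single: "lin h (Poly_Mapping.single k c) = c \<cdot> h k"
  by (simp add: lin_def)

lemma lin_zero [simp]: "lin h 0 = 0"
  by (simp add: lin_def)

lemma lin_sum: "lin h (sum f I) = (\<Sum>i\<in>I. lin h (f i))"
  by (induction I rule: infinite_finite_induct) (auto simp: lin_add)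

lemma scal_assoc: "c \<cdot> d \<cdot> a = (c * d) \<cdot> a"
  by (simp add: mult.assoc[symmetric] mult_single)

lemma poly_mapping_expand: "a = (\<Sum>k\<in>Poly_Mapping.keys a. Poly_Mapping.single k (Poly_Mapping.lookup a k))"
  for a :: "'k \<Rightarrow>\<^sub>0 'b::comm_monoid_add"
  by (rule poly_mapping_eqI) (auto simp: lookup_sum lookup_single when_def in_keys_iff sum.delta)

lemma poly_mapping_induct_add [case_names zero single add]:
  fixes a :: "'k \<Rightarrow>\<^sub>0 'b::comm_monoid_add"
  assumes zero: "P 0" and single: "\<And>k c. P (Poly_Mapping.single k c)"
    and add: "\<And>a b. P a \<Longrightarrow> P b \<Longrightarrow> P (a + b)"
  shows "P a"
proof -
  have "P (\<Sum>k\<in>K. Poly_Mapping.single k (Poly_Mapping.lookup a k))" if "finite K" for K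
    using that by (induction K rule: finite_induct) (auto intro: assms)
  then show ?thesis
    by (subst poly_mapping_expand) simp
qed

lemma lin_scal: "lin h (c \<cdot> a) = c \<cdot> lin h a" for a :: "'k::monoid_add \<Rightarrow>\<^sub>0 complex"
  by (induction a rule: poly_mapping_induct_add)
     (simp_all add: mult_single lin_single distrib_left lin_add scal_assoc)

lemma scal_central: "a * (c \<cdot> b) = c \<cdot> (a * b)" for a b :: "'m::monoid_add \<Rightarrow>\<^sub>0 complex"
proof -
  have comm: "a * Poly_Mapping.single 0 c = c \<cdot> a"
    by (induction a rule: poly_mapping_induct_add) (simp_all add: mult_single algebra_simps)
  show ?thesis
    by (metis comm mult.assoc)
qed

lemma lin_fun_add: "lin (\<lambda>k. f k + g k) a = lin f a + lin g a"
  by (simp add: lin_def distrib_left sum.distrib)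

lemma lin_fun_scal: "lin (\<lambda>k. c \<cdot> f k) a = c \<cdot> lin f a"
  by (simp add: lin_def sum_distrib_left scal_assoc mult.commute)

section \<open>The canonical double bracket\<close>

definition tensor :: "falg \<Rightarrow> falg \<Rightarrow> falg2" (infixr "\<otimes>" 70)
  where "a \<otimes> b = lin (\<lambda>u. lin (\<lambda>v. basis (u, v)) b) a"

text \<open>The outer bimodule structure \<open>a (u \<otimes> v) c = (a u) \<otimes> (v c)\<close>, expressed through the
  algebra structure of \<open>A \<otimes> A\<close>.\<close>

definition outer :: "falg \<Rightarrow> falg2 \<Rightarrow> falg \<Rightarrow> falg2"
  where "outer a t c = (a \<otimes> 1) * t * (1 \<otimes> c)"

definition flip :: "falg2 \<Rightarrow> falg2"
  where "flip = lin (\<lambda>(u, v). basis (v, u))"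

definition mu :: "falg2 \<Rightarrow> falg"
  where "mu = lin (\<lambda>(u, v). basis (u + v))"

definition gen_x :: falg where "gen_x = basis (Word [X])"
definition gen_xstar :: falg where "gen_xstar = basis (Word [Xstar])"

definition canonical_double_bracket :: "(falg \<Rightarrow> falg \<Rightarrow> falg2) \<Rightarrow> bool"
  where "canonical_double_bracket B \<longleftrightarrow>
    (\<forall>a a' b. B (a + a') b = B a b + B a' b) \<and>
    (\<forall>a b b'. B a (b + b') = B a b + B a b') \<and>
    (\<forall>c a b. B (c \<cdot> a) b = c \<cdot> B a b) \<and>
    (\<forall>c a b. B a (c \<cdot> b) = c \<cdot> B a b) \<and>
    B gen_x gen_x = 0 \<and> B gen_xstar gen_xstar = 0 \<and> B gen_x gen_xstar = 1 \<otimes> 1 \<and>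
    (\<forall>a b. B a b = - flip (B b a)) \<and>
    (\<forall>a b c. B a (b * c) = outer b (B a c) 1 + outer 1 (B a b) c)"

definition dbr :: "falg \<Rightarrow> falg \<Rightarrow> falg2"
  where "dbr = (THE B. canonical_double_bracket B)"

lemma tensor_basis: "basis u \<otimes> basis v = basis (u, v)"
  by (simp add: tensor_def lin_single)

lemma one_eq_basis: "1 = basis (0::'m::monoid_add)"
  by simp

lemma outer_add: "outer a (s + t) c = outer a s c + outer a t c"
  by (simp add: outer_def distrib_left distrib_right)

lemma outer_scal: "outer a (c \<cdot> t) b = c \<cdot> outer a t b"
  by (simp add: outer_def scal_central mult.assoc)

lemma tensor_add_left: "(a + a') \<otimes> b = a \<otimes> b + a' \<otimes> b"
  by (simp add: tensor_def lin_add)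

lemma tensor_add_right: "a \<otimes> (b + b') = a \<otimes> b + a \<otimes> b'"
  by (simp add: tensor_def lin_add lin_fun_add)

lemma tensor_scal_left: "(c \<cdot> a) \<otimes> b = c \<cdot> (a \<otimes> b)"
  by (simp add: tensor_def lin_scal)

lemma tensor_scal_right: "a \<otimes> (c \<cdot> b) = c \<cdot> (a \<otimes> b)"
  by (simp add: tensor_def lin_scal lin_fun_scal)

lemma outer_linear_left:
  "outer (a + a') t b = outer a t b + outer a' t b"
  "outer (c \<cdot> a) t b = c \<cdot> outer a t b"
  by (simp_all add: outer_def tensor_add_left tensor_scal_left distrib_right mult.assoc)

lemma outer_linear_right:
  "outer a t (b + b') = outer a t b + outer a t b'"
  "outer a t (c \<cdot> b) = c \<cdot> outer a t b"
  unfolding outer_def tensor_add_right tensor_scal_right distrib_left scal_central by (rule refl)+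

lemma outer_single:
  "outer (basis u) (Poly_Mapping.single (p, q) c) (basis v) = Poly_Mapping.single (u + p, q + v) c"
  unfolding outer_def one_eq_basis tensor_basis by (simp add: mult_single)

lemma outer_single_right_one:
  "outer (basis u) (Poly_Mapping.single (p, q) c) 1 = Poly_Mapping.single (u + p, q) c"
  using outer_single[of u p q c 0] by simp

lemma outer_single_left_one:
  "outer 1 (Poly_Mapping.single (p, q) c) (basis v) = Poly_Mapping.single (p, q + v) c"
  using outer_single[of 0 p q c v] by simp

lemma outer_sum: "outer a (sum f I) c = (\<Sum>i\<in>I. outer a (f i) c)"
  by (simp add: outer_def sum_distrib_left sum_distrib_right)

lemma flip_single: "flip (Poly_Mapping.single (u, v) c) = Poly_Mapping.single (v, u) c"
  by (simp add: flip_def lin_single mult_single)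

lemma flip_sum: "flip (sum f I) = (\<Sum>i\<in>I. flip (f i))"
  by (simp add: flip_def lin_sum)

text \<open>The explicit formula for the bracket of two words only serves to show that the axioms above
  have a (unique) solution.\<close>

fun gen_sign :: "gen \<Rightarrow> gen \<Rightarrow> complex" where
  "gen_sign X Xstar = 1"
| "gen_sign Xstar X = -1"
| "gen_sign _ _ = 0"

lemma gen_sign_swap: "gen_sign g h = - gen_sign h g"
  by (cases g; cases h) auto

definition word_dbr :: "word \<Rightarrow> word \<Rightarrow> falg2"
  where "word_dbr u v = (\<Sum>i<length (letters u). \<Sum>j<length (letters v).
    Poly_Mapping.single
      (Word (take j (letters v) @ drop (Suc i) (letters u)),
       Word (take i (letters u) @ drop (Suc j) (letters v)))
      (gen_sign (letters u ! i) (letters v ! j)))"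

lemma word_dbr_swap: "word_dbr u v = - flip (word_dbr v u)"
proof -
  have "- flip (word_dbr v u) = (\<Sum>j<length (letters v). \<Sum>i<length (letters u).
    Poly_Mapping.single
      (Word (take j (letters v) @ drop (Suc i) (letters u)),
       Word (take i (letters u) @ drop (Suc j) (letters v)))
      (- gen_sign (letters v ! j) (letters u ! i)))"
    by (simp add: word_dbr_def flip_sum flip_single sum_negf single_uminus)
  also have "\<dots> = word_dbr u v"
    unfolding word_dbr_def by (subst sum.swap) (simp add: gen_sign_swap[symmetric])
  finally show ?thesis by simp
qed

lemma sum_lessThan_add: "(\<Sum>j<m + k. f j) = (\<Sum>j<m. f j) + (\<Sum>j<k. f (m + j))"
  for f :: "nat \<Rightarrow> 'a::comm_monoid_add"
  by (induction k) (simp_all add: add.assoc)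

lemma word_dbr_leibniz:
  "word_dbr u (v + w) = outer (basis v) (word_dbr u w) 1 + outer 1 (word_dbr u v) (basis w)"
proof -
  let ?u = "letters u" and ?v = "letters v" and ?w = "letters w"
  have "word_dbr u (v + w) = (\<Sum>i<length ?u.
      (\<Sum>j<length ?v. Poly_Mapping.single
        (Word (take j ?v @ drop (Suc i) ?u), Word (take i ?u @ drop (Suc j) ?v @ ?w))
        (gen_sign (?u ! i) (?v ! j))) +
      (\<Sum>j<length ?w. Poly_Mapping.single
        (Word (?v @ take j ?w @ drop (Suc i) ?u), Word (take i ?u @ drop (Suc j) ?w))
        (gen_sign (?u ! i) (?w ! j))))"
    by (simp add: word_dbr_def plus_word_def sum_lessThan_add nth_append Suc_diff_le)
  also have "\<dots> = outer 1 (word_dbr u v) (basis w) + outer (basis v) (word_dbr u w) 1"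
    by (simp add: word_dbr_def outer_sum outer_single_left_one outer_single_right_one
        plus_word_def sum.distrib)
  finally show ?thesis by (simp add: add.commute)
qed

definition dbr_formula :: "falg \<Rightarrow> falg \<Rightarrow> falg2"
  where "dbr_formula a b = lin (\<lambda>u. lin (\<lambda>v. word_dbr u v) b) a"

lemma dbr_formula_basis: "dbr_formula (basis u) (basis v) = word_dbr u v"
  by (simp add: dbr_formula_def lin_single)

lemma single_eq_scal: "Poly_Mapping.single k c = c \<cdot> basis k" for k :: "'m::monoid_add"
  by (simp add: mult_single)

lemma bilinear_on_basis_eq:
  fixes F G :: "falg \<Rightarrow> falg \<Rightarrow> ('m::monoid_add \<Rightarrow>\<^sub>0 complex)"
  assumes "\<And>a a' b. F (a + a') b = F a b + F a' b" "\<And>a b b'. F a (b + b') = F a b + F a b'"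
    and "\<And>c a b. F (c \<cdot> a) b = c \<cdot> F a b" "\<And>c a b. F a (c \<cdot> b) = c \<cdot> F a b"
    and "\<And>a a' b. G (a + a') b = G a b + G a' b" "\<And>a b b'. G a (b + b') = G a b + G a b'"
    and "\<And>c a b. G (c \<cdot> a) b = c \<cdot> G a b" "\<And>c a b. G a (c \<cdot> b) = c \<cdot> G a b"
    and eq: "\<And>u v. F (basis u) (basis v) = G (basis u) (basis v)"
  shows "F a b = G a b"
proof (induction a rule: poly_mapping_induct_add)
  case zero
  show ?case using assms(3)[of 0 0 b] assms(7)[of 0 0 b] by simp
next
  case (single k c)
  have "F (basis k) b = G (basis k) b"
  proof (induction b rule: poly_mapping_induct_add)
    case zero
    show ?case using assms(4)[of _ 0 0] assms(8)[of _ 0 0] by simp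
  next
    case (single l d)
    show ?case by (subst (1 2) single_eq_scal) (simp only: assms(4,8) eq)
  next
    case (add a b)
    then show ?case by (simp add: assms)
  qed
  then show ?case by (subst (1 2) single_eq_scal) (simp only: assms(3,7))
next
  case (add a b)
  then show ?case by (simp add: assms)
qed

lemma dbr_formula_bilinear:
  "dbr_formula (a + a') b = dbr_formula a b + dbr_formula a' b"
  "dbr_formula a (b + b') = dbr_formula a b + dbr_formula a b'"
  "dbr_formula (c \<cdot> a) b = c \<cdot> dbr_formula a b"
  "dbr_formula a (c \<cdot> b) = c \<cdot> dbr_formula a b"
  by (simp_all add: dbr_formula_def lin_add lin_fun_add lin_scal lin_fun_scal)

lemma dbr_formula_leibniz:
  "dbr_formula a (b * c) = outer b (dbr_formula a c) 1 + outer 1 (dbr_formula a b) c"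
proof (induction a rule: poly_mapping_induct_add)
  case zero
  show ?case by (simp add: dbr_formula_def outer_def)
next
  case (single u r)
  have "dbr_formula (basis u) (b * c)
      = outer b (dbr_formula (basis u) c) 1 + outer 1 (dbr_formula (basis u) b) c"
  proof (rule bilinear_on_basis_eq[of "\<lambda>b c. dbr_formula (basis u) (b * c)"
        "\<lambda>b c. outer b (dbr_formula (basis u) c) 1 + outer 1 (dbr_formula (basis u) b) c"])
    fix v w :: word
    have "basis v * basis w = basis (v + w)"
      by (simp add: mult_single)
    then show "dbr_formula (basis u) (basis v * basis w)
      = outer (basis v) (dbr_formula (basis u) (basis w)) 1
        + outer 1 (dbr_formula (basis u) (basis v)) (basis w)"
      by (simp only: dbr_formula_basis word_dbr_leibniz)
  qed (simp_all only: outer_linear_left outer_linear_right outer_add outer_scal dbr_formula_bilinear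
        distrib_left distrib_right mult.assoc scal_central add_ac)
  then show ?case
    by (subst (1 2 3) single_eq_scal) (simp only: dbr_formula_bilinear outer_scal distrib_left)
next
  case (add a a')
  then show ?case by (simp add: dbr_formula_bilinear outer_add)
qed

lemma canonical_dbr_formula: "canonical_double_bracket dbr_formula"
proof -
  have flip: "dbr_formula a b = - flip (dbr_formula b a)" for a b
    by (rule bilinear_on_basis_eq[of dbr_formula "\<lambda>a b. - flip (dbr_formula b a)"])
       (simp_all add: dbr_formula_bilinear dbr_formula_basis flip_def lin_add lin_scal
          word_dbr_swap[unfolded flip_def, symmetric])
  have "1 \<otimes> 1 = basis (0, 0)"
    unfolding one_eq_basis tensor_basis ..
  then have "dbr_formula gen_x gen_x = 0" "dbr_formula gen_xstar gen_xstar = 0"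
      "dbr_formula gen_x gen_xstar = 1 \<otimes> 1"
    by (simp_all add: gen_x_def gen_xstar_def dbr_formula_basis word_dbr_def zero_word_def)
  with flip show ?thesis
    unfolding canonical_double_bracket_def
    by (intro conjI allI) (rule dbr_formula_bilinear dbr_formula_leibniz | assumption)+
qed

lemma canonical_double_bracket_unique:
  assumes B: "canonical_double_bracket B" and C: "canonical_double_bracket C"
  shows "B = C"
proof -
  have lin: "D (a + a') b = D a b + D a' b" "D a (b + b') = D a b + D a b'"
      "D (c \<cdot> a) b = c \<cdot> D a b" "D a (c \<cdot> b) = c \<cdot> D a b"
    and gens: "D gen_x gen_x = 0" "D gen_xstar gen_xstar = 0" "D gen_x gen_xstar = 1 \<otimes> 1"
    and flip: "D a b = - flip (D b a)"
    and leib: "D a (b * b') = outer b (D a b') 1 + outer 1 (D a b) b'"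
    if "canonical_double_bracket D" for D a a' b b' c
    using that unfolding canonical_double_bracket_def by blast+
  have one: "D a 1 = 0" if D: "canonical_double_bracket D" for D a
  proof -
    have "outer 1 t 1 = t" for t
    proof -
      have "1 \<otimes> 1 = (1 :: falg2)"
        unfolding one_eq_basis tensor_basis by (simp add: zero_prod_def)
      then show ?thesis by (simp add: outer_def)
    qed
    then show ?thesis using leib[OF D, of a 1 1] by simp
  qed
  have gg: "B (basis (Word [g])) (basis (Word [h])) = C (basis (Word [g])) (basis (Word [h]))" for g h
    using gens[OF B] gens[OF C] flip[OF B, of gen_xstar gen_x] flip[OF C, of gen_xstar gen_x]
    by (cases g; cases h) (simp_all add: gen_x_def gen_xstar_def)
  have cons: "basis (Word (g # gs)) = basis (Word [g]) * basis (Word gs)" for g gs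
    by (simp add: mult_single plus_word_def)
  have nil: "basis (Word []) = 1"
    by (simp add: zero_word_def[symmetric])
  have step: "B a (basis (Word vs)) = C a (basis (Word vs))"
    if "\<And>h. B a (basis (Word [h])) = C a (basis (Word [h]))" for a vs
  proof (induction vs)
    case Nil
    show ?case unfolding nil by (simp add: one B C)
  next
    case (Cons h vs)
    then show ?case
      by (subst (1 2) cons) (simp only: leib[OF B] leib[OF C] that)
  qed
  have "B (basis u) (basis v) = C (basis u) (basis v)" for u v
  proof -
    have "B (basis (Word [h])) (basis u) = C (basis (Word [h])) (basis u)" for h
      using step[of "basis (Word [h])" "letters u"] gg by simp
    then have "B (basis u) (basis (Word [h])) = C (basis u) (basis (Word [h]))" for h
      by (metis flip[OF B] flip[OF C])
    then show ?thesis
      using step[of "basis u" "letters v"] by simp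
  qed
  then have "B a b = C a b" for a b
    by (rule bilinear_on_basis_eq[of B C, rotated 8]) (simp_all only: lin[OF B] lin[OF C])
  then show ?thesis by blast
qed

lemma canonical_dbr: "canonical_double_bracket dbr"
  unfolding dbr_def
  by (rule theI[of _ dbr_formula])
     (use canonical_dbr_formula canonical_double_bracket_unique in blast)+

section \<open>The Lie algebra \<open>A / [A, A]\<close>\<close>

lemma module_scal: "module (\<lambda>c (a::'m::monoid_add \<Rightarrow>\<^sub>0 complex). c \<cdot> a)"
  by standard (simp_all add: distrib_left distrib_right single_add scal_assoc)

definition commutator_space :: "falg set"
  where "commutator_space = module.span (\<lambda>c a. c \<cdot> a) {a * b - b * a | a b. True}"

lemma commutator_space_closed:
  "0 \<in> commutator_space"
  "a \<in> commutator_space \<Longrightarrow> b \<in> commutator_space \<Longrightarrow> a + b \<in> commutator_space"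
  "a \<in> commutator_space \<Longrightarrow> b \<in> commutator_space \<Longrightarrow> a - b \<in> commutator_space"
  "a \<in> commutator_space \<Longrightarrow> - a \<in> commutator_space"
  "a \<in> commutator_space \<Longrightarrow> c \<cdot> a \<in> commutator_space"
  "a * b - b * a \<in> commutator_space"
proof -
  show "a * b - b * a \<in> commutator_space"
    unfolding commutator_space_def by (rule module.span_base[OF module_scal]) blast
qed (simp_all add: commutator_space_def module.span_zero[OF module_scal]
    module.span_add[OF module_scal] module.span_diff[OF module_scal]
    module.span_neg[OF module_scal] module.span_scale[OF module_scal])

quotient_type cyc = falg / "\<lambda>a b. a - b \<in> commutator_space"
proof (rule equivpI)
  show "reflp (\<lambda>a b. a - b \<in> commutator_space)"
    by (simp add: reflp_def commutator_space_closed)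
  show "symp (\<lambda>a b. a - b \<in> commutator_space)"
    using commutator_space_closed(4) by (force simp: symp_def)
  show "transp (\<lambda>a b. a - b \<in> commutator_space)"
    using commutator_space_closed(2) by (force simp: transp_def)
qed

instantiation cyc :: ab_group_add
begin
lift_definition zero_cyc :: cyc is 0 .
lift_definition plus_cyc :: "cyc \<Rightarrow> cyc \<Rightarrow> cyc" is "(+)"
  using commutator_space_closed(2) by (force simp: algebra_simps)
lift_definition minus_cyc :: "cyc \<Rightarrow> cyc \<Rightarrow> cyc" is "(-)"
  using commutator_space_closed(3) by (force simp: algebra_simps)
lift_definition uminus_cyc :: "cyc \<Rightarrow> cyc" is uminus
  using commutator_space_closed(4) by (force simp: algebra_simps)
instance
  by standard (transfer; simp add: algebra_simps commutator_space_closed)+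
end

lift_definition scale_cyc :: "complex \<Rightarrow> cyc \<Rightarrow> cyc" is "\<lambda>c a. c \<cdot> a"
  by (metis commutator_space_closed(5) right_diff_distrib)

lemma mu_add: "mu (s + t) = mu s + mu t"
  by (simp add: mu_def lin_add)

lemma mu_uminus: "mu (- t) = - mu t"
  using mu_add[of t "- t"] by (simp add: mu_def eq_neg_iff_add_eq_0 add.commute)

lemma mu_diff: "mu (s - t) = mu s - mu t"
  using mu_add[of "s - t" t] by simp

lemma mu_scal: "mu (c \<cdot> t) = c \<cdot> mu t"
  by (simp add: mu_def lin_scal)

lemma mu_flip: "mu (flip t) - mu t \<in> commutator_space"
proof (induction t rule: poly_mapping_induct_add)
  case zero
  show ?case by (simp add: mu_def flip_def commutator_space_closed)
next
  case (single k c)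
  obtain u v where k: "k = (u, v)" by force
  have "mu (flip (Poly_Mapping.single k c)) - mu (Poly_Mapping.single k c)
      = Poly_Mapping.single v c * basis u - basis u * Poly_Mapping.single v c"
    by (simp add: k flip_single mu_def lin_single mult_single)
  then show ?case by (simp only: commutator_space_closed)
next
  case (add a b)
  then show ?case
    using commutator_space_closed(2)[OF add] by (simp add: mu_add flip_def lin_add algebra_simps)
qed

lemma mu_outer: "mu (outer a t b) = a * mu t * b"
proof -
  have basis: "mu (outer (basis u) t (basis v)) = basis u * mu t * basis v" for u v t
  proof (induction t rule: poly_mapping_induct_add)
    case zero
    show ?case by (simp add: mu_def outer_def)
  next
    case (single k c)
    obtain p q where "k = (p, q)" by force
    then show ?case by (simp add: outer_single mu_def lin_single mult_single add.assoc)
  next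
    case (add s t)
    then show ?case by (simp add: outer_add mu_add distrib_left distrib_right)
  qed
  show ?thesis
    by (rule bilinear_on_basis_eq[of "\<lambda>a b. mu (outer a t b)" "\<lambda>a b. a * mu t * b"])
       (simp_all only: outer_linear_left outer_linear_right mu_add mu_scal distrib_left
          distrib_right mult.assoc scal_central basis[unfolded mult.assoc])
qed

lemma dbr_bilinear:
  "dbr (a + a') b = dbr a b + dbr a' b"
  "dbr a (b + b') = dbr a b + dbr a b'"
  "dbr (c \<cdot> a) b = c \<cdot> dbr a b"
  "dbr a (c \<cdot> b) = c \<cdot> dbr a b"
  and dbr_antisym: "dbr a b = - flip (dbr b a)"
  and dbr_leibniz: "dbr a (b * d) = outer b (dbr a d) 1 + outer 1 (dbr a b) d"
  using canonical_dbr unfolding canonical_double_bracket_def by blast+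

lemma dbr_diff:
  "dbr (a - a') b = dbr a b - dbr a' b"
  "dbr a (b - b') = dbr a b - dbr a b'"
  using dbr_bilinear(1)[of "a - a'" a' b] dbr_bilinear(2)[of a "b - b'" b']
  by (simp_all add: algebra_simps)

lemma mu_dbr_swap: "mu (dbr a b) + mu (dbr b a) \<in> commutator_space"
  using commutator_space_closed(4)[OF mu_flip[of "dbr b a"]]
  by (simp add: dbr_antisym[of a b] mu_uminus algebra_simps)

lemma mu_dbr_commutator_right:
  assumes "c \<in> commutator_space"
  shows "mu (dbr a c) \<in> commutator_space"
  using assms unfolding commutator_space_def
proof (induction rule: module.span_induct_alt[OF module_scal, consumes 1, case_names base step])
  case base
  have "dbr a 0 = 0" using dbr_bilinear(2)[of a 0 0] by simp
  then show ?case
    using commutator_space_closed(1) by (simp add: mu_def commutator_space_def)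
next
  case (step r x y)
  then obtain b d where x: "x = b * d - d * b" by blast
  have "mu (dbr a x) = (b * mu (dbr a d) - mu (dbr a d) * b) + (mu (dbr a b) * d - d * mu (dbr a b))"
    by (simp add: x dbr_diff dbr_leibniz mu_add mu_outer mu_diff)
  then have "mu (dbr a x) \<in> commutator_space"
    by (simp only: commutator_space_closed)
  then have "mu (dbr a (r \<cdot> x + y)) \<in> commutator_space"
    using step unfolding dbr_bilinear mu_add mu_scal commutator_space_def[symmetric]
    by (intro commutator_space_closed)
  then show ?case by (simp add: commutator_space_def)
qed

lemma mu_dbr_commutator_left:
  assumes "c \<in> commutator_space"
  shows "mu (dbr c a) \<in> commutator_space"
  using commutator_space_closed(3)[OF mu_dbr_swap[of c a] mu_dbr_commutator_right[OF assms, of a]]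
  by simp

lift_definition lie :: "cyc \<Rightarrow> cyc \<Rightarrow> cyc" is "\<lambda>a b. mu (dbr a b)"
proof -
  fix a a' b b' :: falg
  assume "a - a' \<in> commutator_space" "b - b' \<in> commutator_space"
  then have "mu (dbr (a - a') b) + mu (dbr a' (b - b')) \<in> commutator_space"
    by (intro commutator_space_closed(2) mu_dbr_commutator_left mu_dbr_commutator_right)
  then show "mu (dbr a b) - mu (dbr a' b') \<in> commutator_space"
    by (simp add: dbr_diff mu_diff)
qed

lemma lie_bilinear:
  "lie (u + u') v = lie u v + lie u' v"
  "lie u (v + v') = lie u v + lie u v'"
  "lie (scale_cyc c u) v = scale_cyc c (lie u v)"
  "lie u (scale_cyc c v) = scale_cyc c (lie u v)"
  by (transfer; simp add: dbr_bilinear mu_add mu_scal commutator_space_closed)+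

lemma lie_antisym: "lie u v = - lie v u"
  by transfer (simp add: mu_dbr_swap)

section \<open>The Lie-Poisson algebra \<open>S(A / [A, A])\<close>\<close>

type_synonym 'v cpoly = "('v \<Rightarrow>\<^sub>0 nat) \<Rightarrow>\<^sub>0 complex"

definition Var :: "'v \<Rightarrow> 'v cpoly"
  where "Var v = basis (Poly_Mapping.single v 1)"

definition pd :: "'v \<Rightarrow> 'v cpoly \<Rightarrow> 'v cpoly"
  where "pd v = lin (\<lambda>m. Poly_Mapping.single (m - Poly_Mapping.single v 1)
    (of_nat (Poly_Mapping.lookup m v)))"

definition vars :: "'v cpoly \<Rightarrow> 'v set"
  where "vars P = (\<Union>m\<in>Poly_Mapping.keys P. Poly_Mapping.keys m)"

definition lie_poisson_poly :: "('v \<Rightarrow> 'v \<Rightarrow> 'v) \<Rightarrow> 'v cpoly \<Rightarrow> 'v cpoly \<Rightarrow> 'v cpoly"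
  where "lie_poisson_poly br P Q = (\<Sum>u\<in>vars P. \<Sum>v\<in>vars Q. pd u P * pd v Q * Var (br u v))"

text \<open>The symmetric algebra of \<open>\<nn> = A / [A, A]\<close> is the polynomial ring on the underlying set
  of \<open>\<nn>\<close> modulo the ideal generated by the linear relations of \<open>\<nn>\<close>; for a ring as a module over
  itself, \<^const>\<open>module.span\<close> yields the generated ideal.\<close>

definition sym_ideal :: "cyc cpoly set"
  where "sym_ideal = module.span (*)
    ({Var (u + v) - Var u - Var v | u v. True} \<union>
     {Var (scale_cyc c u) - c \<cdot> Var u | c u. True})"

lemma module_times: "module ((*) :: 'r::comm_ring_1 \<Rightarrow> 'r \<Rightarrow> 'r)"
  by standard (simp_all add: algebra_simps)

lemma sym_ideal_closed:
  "0 \<in> sym_ideal"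
  "P \<in> sym_ideal \<Longrightarrow> Q \<in> sym_ideal \<Longrightarrow> P + Q \<in> sym_ideal"
  "P \<in> sym_ideal \<Longrightarrow> Q \<in> sym_ideal \<Longrightarrow> P - Q \<in> sym_ideal"
  "P \<in> sym_ideal \<Longrightarrow> - P \<in> sym_ideal"
  "P \<in> sym_ideal \<Longrightarrow> R * P \<in> sym_ideal"
  by (simp_all add: sym_ideal_def module.span_zero[OF module_times]
    module.span_add[OF module_times] module.span_diff[OF module_times]
    module.span_neg[OF module_times] module.span_scale[OF module_times])

lemma sym_ideal_sum: "(\<And>i. i \<in> I \<Longrightarrow> f i \<in> sym_ideal) \<Longrightarrow> sum f I \<in> sym_ideal"
  unfolding sym_ideal_def by (rule module.span_sum[OF module_times])

lemma sym_ideal_gens: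
  "Var (u + v) - Var u - Var v \<in> sym_ideal"
  "Var (scale_cyc c u) - c \<cdot> Var u \<in> sym_ideal"
  unfolding sym_ideal_def by (rule module.span_base[OF module_times]; blast)+

quotient_type sym_cyc = "cyc cpoly" / "\<lambda>P Q. P - Q \<in> sym_ideal"
proof (rule equivpI)
  show "reflp (\<lambda>a b. a - b \<in> sym_ideal)"
    by (simp add: reflp_def sym_ideal_closed)
  show "symp (\<lambda>a b. a - b \<in> sym_ideal)"
    using sym_ideal_closed(4) by (force simp: symp_def)
  show "transp (\<lambda>a b. a - b \<in> sym_ideal)"
    using sym_ideal_closed(2) by (force simp: transp_def)
qed

lemma pd_add: "pd v (P + Q) = pd v P + pd v Q"
  by (simp add: pd_def lin_add)

lemma pd_scal: "pd v (c \<cdot> P) = c \<cdot> pd v P"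
  by (simp add: pd_def lin_scal)

lemma pd_diff: "pd v (P - Q) = pd v P - pd v Q"
  using pd_add[of v "P - Q" Q] by simp

lemma pd_single: "pd v (Poly_Mapping.single m c)
  = Poly_Mapping.single (m - Poly_Mapping.single v 1) (c * of_nat (Poly_Mapping.lookup m v))"
  by (simp add: pd_def lin_single mult_single)

lemma pd_Var: "pd v (Var w) = (if v = w then 1 else 0)"
  by (auto simp: Var_def pd_single lookup_single)

lemma pd_zero [simp]: "pd v 0 = 0"
  by (simp add: pd_def)

lemma pd_mult: "pd v (P * Q) = pd v P * Q + P * pd v Q"
proof (induction P rule: poly_mapping_induct_add)
  case zero
  show ?case by simp
next
  case (single m c)
  show ?case
  proof (induction Q rule: poly_mapping_induct_add)
    case zero
    show ?case by simp
  next
    case (single m' d)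
    let ?e = "Poly_Mapping.single v (1::nat)"
    have shift: "k + k' - ?e = (k - ?e) + k'" if "Poly_Mapping.lookup k v \<noteq> 0"
      for k k' :: "'a \<Rightarrow>\<^sub>0 nat"
      using that by (intro poly_mapping_eqI) (auto simp: lookup_add lookup_minus lookup_single when_def)
    have l: "Poly_Mapping.single (m + m' - ?e) (r * of_nat (Poly_Mapping.lookup m v))
        = Poly_Mapping.single ((m - ?e) + m') (r * of_nat (Poly_Mapping.lookup m v))" for r :: complex
      by (cases "Poly_Mapping.lookup m v = 0") (simp_all add: shift del: One_nat_def)
    have r: "Poly_Mapping.single (m + m' - ?e) (r * of_nat (Poly_Mapping.lookup m' v))
        = Poly_Mapping.single (m + (m' - ?e)) (r * of_nat (Poly_Mapping.lookup m' v))" for r :: complex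
      using shift[of m' m] by (cases "Poly_Mapping.lookup m' v = 0") (simp_all add: add.commute)
    have "pd v (Poly_Mapping.single m c * Poly_Mapping.single m' d)
      = Poly_Mapping.single (m + m' - ?e) (c * d * of_nat (Poly_Mapping.lookup m v))
        + Poly_Mapping.single (m + m' - ?e) (c * d * of_nat (Poly_Mapping.lookup m' v))"
      by (simp add: mult_single pd_single lookup_add distrib_left single_add)
    then show ?case
      unfolding l r by (simp add: mult_single pd_single mult_ac add_ac)
  next
    case (add P Q)
    then show ?case by (simp add: distrib_left pd_add)
  qed
next
  case (add P P')
  then show ?case by (simp add: distrib_right pd_add)
qed

lemma finite_vars: "finite (vars P)"
  by (simp add: vars_def)

lemma pd_not_in_vars: "v \<notin> vars P \<Longrightarrow> pd v P = 0"
  unfolding pd_def lin_def vars_def by (intro sum.neutral) (auto simp: in_keys_iff)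

lemma lie_poisson_poly_superset:
  assumes "finite U" "vars P \<subseteq> U" "finite V" "vars Q \<subseteq> V"
  shows "lie_poisson_poly br P Q = (\<Sum>u\<in>U. \<Sum>v\<in>V. pd u P * pd v Q * Var (br u v))"
proof -
  have "lie_poisson_poly br P Q = (\<Sum>u\<in>vars P. \<Sum>v\<in>V. pd u P * pd v Q * Var (br u v))"
    unfolding lie_poisson_poly_def using assms
    by (intro sum.cong refl sum.mono_neutral_left) (auto simp: pd_not_in_vars)
  also have "\<dots> = (\<Sum>u\<in>U. \<Sum>v\<in>V. pd u P * pd v Q * Var (br u v))"
    using assms by (intro sum.mono_neutral_left) (auto simp: pd_not_in_vars)
  finally show ?thesis .
qed

lemma lie_poisson_poly_add_left:
  "lie_poisson_poly br (P + P') Q = lie_poisson_poly br P Q + lie_poisson_poly br P' Q"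
proof -
  let ?U = "vars P \<union> vars P' \<union> vars (P + P')"
  have "lie_poisson_poly br R Q = (\<Sum>u\<in>?U. \<Sum>v\<in>vars Q. pd u R * pd v Q * Var (br u v))"
    if "vars R \<subseteq> ?U" for R
    using that by (intro lie_poisson_poly_superset) (auto simp: finite_vars)
  then show ?thesis
    by (simp add: pd_add distrib_right sum.distrib le_supI1)
qed

lemma lie_poisson_poly_mult_left:
  "lie_poisson_poly br (P * P') Q = P * lie_poisson_poly br P' Q + P' * lie_poisson_poly br P Q"
proof -
  let ?U = "vars P \<union> vars P' \<union> vars (P * P')"
  have "lie_poisson_poly br R Q = (\<Sum>u\<in>?U. \<Sum>v\<in>vars Q. pd u R * pd v Q * Var (br u v))"
    if "vars R \<subseteq> ?U" for R
    using that by (intro lie_poisson_poly_superset) (auto simp: finite_vars)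
  then show ?thesis
    by (simp add: pd_mult algebra_simps sum.distrib sum_distrib_left le_supI1)
qed

lemma lie_poisson_poly_swap:
  "lie_poisson_poly br P Q = lie_poisson_poly (\<lambda>u v. br v u) Q P"
  unfolding lie_poisson_poly_def by (subst sum.swap) (simp add: mult_ac)

lemma lie_poisson_poly_zero [simp]: "lie_poisson_poly br 0 Q = 0"
  by (simp add: lie_poisson_poly_def vars_def)

lemma lie_poisson_poly_diff_left:
  "lie_poisson_poly br (P - P') Q = lie_poisson_poly br P Q - lie_poisson_poly br P' Q"
  using lie_poisson_poly_add_left[of br "P - P'" P' Q] by simp

lemma lie_poisson_poly_diff_right:
  "lie_poisson_poly br Q (P - P') = lie_poisson_poly br Q P - lie_poisson_poly br Q P'"
  by (simp only: lie_poisson_poly_swap[of br Q] lie_poisson_poly_diff_left)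

lemma vars_Var: "vars (Var u) = {u}"
  by (simp add: vars_def Var_def)

lemma lie_poisson_poly_Var: "lie_poisson_poly br (Var u) (Var v) = Var (br u v)"
  by (simp add: lie_poisson_poly_def vars_Var pd_Var)

lemma lie_poisson_poly_Var_left:
  "lie_poisson_poly br (Var u) Q = (\<Sum>v\<in>vars Q. pd v Q * Var (br u v))"
  by (simp add: lie_poisson_poly_def vars_Var pd_Var)

lemma lie_poisson_poly_scal_left:
  "lie_poisson_poly br (c \<cdot> P) Q = c \<cdot> lie_poisson_poly br P Q"
proof -
  have "pd v (Poly_Mapping.single 0 c) = 0" for v :: 'a
    by (simp add: pd_single)
  then have "lie_poisson_poly br (Poly_Mapping.single 0 c) Q = 0"
    by (simp add: lie_poisson_poly_def)
  then show ?thesis by (simp add: lie_poisson_poly_mult_left)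
qed

lemma lie_poisson_poly_sym_ideal:
  assumes "\<And>u u' v. br (u + u') v = br u v + br u' v"
    and "\<And>c u v. br (scale_cyc c u) v = scale_cyc c (br u v)"
    and "P \<in> sym_ideal"
  shows "lie_poisson_poly br P Q \<in> sym_ideal"
proof -
  have sub: "R \<in> sym_ideal \<Longrightarrow> lie_poisson_poly br R Q \<in> sym_ideal \<Longrightarrow>
      lie_poisson_poly br (S * R) Q \<in> sym_ideal" for R S
    by (subst lie_poisson_poly_mult_left)
       (auto intro!: sym_ideal_closed simp: mult.commute[of R])
  have gen1: "lie_poisson_poly br (Var (u + v) - Var u - Var v) Q \<in> sym_ideal" for u v
  proof -
    have "lie_poisson_poly br (Var (u + v) - Var u - Var v) Q
        = (\<Sum>w\<in>vars Q. pd w Q * (Var (br u w + br v w) - Var (br u w) - Var (br v w)))"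
      by (simp add: lie_poisson_poly_diff_left lie_poisson_poly_Var_left assms sum_subtractf
          right_diff_distrib)
    then show ?thesis
      by (simp only:) (intro sym_ideal_sum sym_ideal_closed sym_ideal_gens)
  qed
  have gen2: "lie_poisson_poly br (Var (scale_cyc c u) - c \<cdot> Var u) Q \<in> sym_ideal" for c u
  proof -
    have "lie_poisson_poly br (Var (scale_cyc c u) - c \<cdot> Var u) Q
        = (\<Sum>w\<in>vars Q. pd w Q * (Var (scale_cyc c (br u w)) - c \<cdot> Var (br u w)))"
      by (simp add: lie_poisson_poly_diff_left lie_poisson_poly_scal_left lie_poisson_poly_Var_left
          assms sum_subtractf right_diff_distrib sum_distrib_left mult.left_commute)
    then show ?thesis
      by (simp only:) (intro sym_ideal_sum sym_ideal_closed sym_ideal_gens)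
  qed
  have "P \<in> sym_ideal \<and> lie_poisson_poly br P Q \<in> sym_ideal"
    using assms(3) unfolding sym_ideal_def
  proof (induction rule: module.span_induct_alt[OF module_times, consumes 1, case_names base step])
    case base
    show ?case using sym_ideal_closed(1) by (simp add: sym_ideal_def)
  next
    case (step S R P)
    then have R: "R \<in> sym_ideal" "lie_poisson_poly br R Q \<in> sym_ideal"
      using gen1 gen2 sym_ideal_gens by auto
    have P: "P \<in> sym_ideal" "lie_poisson_poly br P Q \<in> sym_ideal"
      using step by (simp_all add: sym_ideal_def)
    have "S * R + P \<in> sym_ideal \<and> lie_poisson_poly br (S * R + P) Q \<in> sym_ideal"
      unfolding lie_poisson_poly_add_left
      using sub[OF R, of S] sym_ideal_closed(5)[OF R(1), of S] P by (blast intro: sym_ideal_closed(2))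
    then show ?case unfolding sym_ideal_def .
  qed
  then show ?thesis by blast
qed

lift_definition lie_poisson :: "sym_cyc \<Rightarrow> sym_cyc \<Rightarrow> sym_cyc" is "lie_poisson_poly lie"
proof -
  fix P P' Q Q' :: "cyc cpoly"
  assume P: "P - P' \<in> sym_ideal" and Q: "Q - Q' \<in> sym_ideal"
  have "lie_poisson_poly lie (P - P') Q \<in> sym_ideal"
    by (rule lie_poisson_poly_sym_ideal) (simp_all add: lie_bilinear P)
  moreover have "lie_poisson_poly lie P' (Q - Q') \<in> sym_ideal"
    unfolding lie_poisson_poly_swap[of lie P']
    by (rule lie_poisson_poly_sym_ideal) (simp_all add: lie_bilinear Q)
  ultimately have "lie_poisson_poly lie (P - P') Q + lie_poisson_poly lie P' (Q - Q') \<in> sym_ideal"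
    by (rule sym_ideal_closed)
  then show "lie_poisson_poly lie P Q - lie_poisson_poly lie P' Q' \<in> sym_ideal"
    by (simp add: lie_poisson_poly_diff_left lie_poisson_poly_diff_right)
qed

section \<open>Representations and their invariants\<close>

type_synonym 'n rep = "(complex^'n^'n) \<times> (complex^'n^'n)"

inductive_set coord_ring_rep :: "('n::finite rep \<Rightarrow> complex) set" where
  const: "(\<lambda>_. c) \<in> coord_ring_rep"
| entry_x: "(\<lambda>p. fst p $ i $ j) \<in> coord_ring_rep"
| entry_xstar: "(\<lambda>p. snd p $ i $ j) \<in> coord_ring_rep"
| add: "f \<in> coord_ring_rep \<Longrightarrow> g \<in> coord_ring_rep \<Longrightarrow> f + g \<in> coord_ring_rep"
| mult: "f \<in> coord_ring_rep \<Longrightarrow> g \<in> coord_ring_rep \<Longrightarrow> f * g \<in> coord_ring_rep"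

definition gl_act :: "complex^'n^'n \<Rightarrow> 'n::finite rep \<Rightarrow> 'n rep"
  where "gl_act g p = (g ** fst p ** matrix_inv g, g ** snd p ** matrix_inv g)"

definition coord_ring_iss :: "('n::finite rep \<Rightarrow> complex) set"
  where "coord_ring_iss = {f \<in> coord_ring_rep. \<forall>g. invertible g \<longrightarrow> (\<forall>p. f (gl_act g p) = f p)}"

fun eval_gen :: "'n::finite rep \<Rightarrow> gen \<Rightarrow> complex^'n^'n" where
  "eval_gen p X = fst p"
| "eval_gen p Xstar = snd p"

definition eval_word :: "'n::finite rep \<Rightarrow> word \<Rightarrow> complex^'n^'n"
  where "eval_word p w = foldr (\<lambda>g M. eval_gen p g ** M) (letters w) (mat 1)"

definition lin_eval :: "('k \<Rightarrow> complex) \<Rightarrow> ('k \<Rightarrow>\<^sub>0 complex) \<Rightarrow> complex"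
  where "lin_eval h a = (\<Sum>k\<in>Poly_Mapping.keys a. Poly_Mapping.lookup a k * h k)"

lemma lin_eval_superset:
  assumes "finite K" "Poly_Mapping.keys a \<subseteq> K"
  shows "lin_eval h a = (\<Sum>k\<in>K. Poly_Mapping.lookup a k * h k)"
  unfolding lin_eval_def using assms
  by (intro sum.mono_neutral_left) (auto simp: in_keys_iff)

lemma lin_eval_add: "lin_eval h (a + b) = lin_eval h a + lin_eval h b"
proof -
  let ?K = "Poly_Mapping.keys a \<union> Poly_Mapping.keys b"
  have "lin_eval h (a + b) = (\<Sum>k\<in>?K. Poly_Mapping.lookup (a + b) k * h k)"
    by (rule lin_eval_superset) (use Poly_Mapping.keys_add[of a b] in auto)
  then show ?thesis
    by (simp add: lin_eval_superset[of ?K] lookup_add distrib_right sum.distrib)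
qed

lemma lin_eval_diff: "lin_eval h (a - b) = lin_eval h a - lin_eval h b"
  using lin_eval_add[of h "a - b" b] by simp

lemma lin_eval_single: "lin_eval h (Poly_Mapping.single k c) = c * h k"
  by (simp add: lin_eval_def)

lemma lin_eval_zero [simp]: "lin_eval h 0 = 0"
  by (simp add: lin_eval_def)

lemma lin_eval_scal: "lin_eval h (c \<cdot> a) = c * lin_eval h a" for a :: "'k::monoid_add \<Rightarrow>\<^sub>0 complex"
  by (induction a rule: poly_mapping_induct_add)
     (simp_all add: mult_single lin_eval_single distrib_left lin_eval_add)

lemma eval_word_add: "eval_word p (u + v) = eval_word p u ** eval_word p v"
proof -
  have "foldr (\<lambda>g M. eval_gen p g ** M) gs N
      = foldr (\<lambda>g M. eval_gen p g ** M) gs (mat 1) ** N" for gs N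
    by (induction gs) (simp_all add: matrix_mul_assoc)
  then show ?thesis by (simp add: eval_word_def plus_word_def)
qed

definition trace_falg :: "'n::finite rep \<Rightarrow> falg \<Rightarrow> complex"
  where "trace_falg p = lin_eval (\<lambda>w. trace (eval_word p w))"

lemma trace_falg_mult_comm: "trace_falg p (a * b) = trace_falg p (b * a)"
proof (induction a rule: poly_mapping_induct_add)
  case zero
  show ?case by simp
next
  case (single u c)
  show ?case
  proof (induction b rule: poly_mapping_induct_add)
    case zero
    show ?case by simp
  next
    case (single v d)
    have "trace (eval_word p (u + v)) = trace (eval_word p (v + u))"
      unfolding eval_word_add by (rule trace_mul_sym)
    then show ?case by (simp add: trace_falg_def mult_single lin_eval_single)
  next
    case (add a b)
    then show ?case by (simp add: trace_falg_def lin_eval_add distrib_left distrib_right)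
  qed
next
  case (add a b)
  then show ?case by (simp add: trace_falg_def lin_eval_add distrib_left distrib_right)
qed

lemma trace_falg_commutator:
  assumes "a \<in> commutator_space"
  shows "trace_falg p a = 0"
  using assms unfolding commutator_space_def
  by (induction rule: module.span_induct_alt[OF module_scal, consumes 1])
     (auto simp: trace_falg_def lin_eval_add lin_eval_scal lin_eval_diff
        trace_falg_mult_comm[unfolded trace_falg_def])

lift_definition tr :: "cyc \<Rightarrow> 'n::finite rep \<Rightarrow> complex" is "\<lambda>a p. trace_falg p a"
proof
  fix a b :: falg and p :: "'n rep"
  assume "a - b \<in> commutator_space"
  from trace_falg_commutator[OF this, of p] show "trace_falg p a = trace_falg p b"
    by (simp add: trace_falg_def lin_eval_diff)
qed

lemma tr_linear:
  "tr (u + v) p = tr u p + tr v p"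
  "tr (scale_cyc c u) p = c * tr u p"
  by (transfer; simp add: trace_falg_def lin_eval_add lin_eval_scal)+

definition insertion :: "('v \<Rightarrow> complex) \<Rightarrow> 'v cpoly \<Rightarrow> complex"
  where "insertion t = lin_eval (\<lambda>m. \<Prod>v\<in>Poly_Mapping.keys m. t v ^ Poly_Mapping.lookup m v)"

lemma insertion_mult: "insertion t (P * Q) = insertion t P * insertion t Q"
proof -
  define h where "h m = (\<Prod>v\<in>Poly_Mapping.keys m. t v ^ Poly_Mapping.lookup m v)" for m
  have sup: "h m = (\<Prod>v\<in>V. t v ^ Poly_Mapping.lookup m v)"
    if "finite V" "Poly_Mapping.keys m \<subseteq> V" for m V
    unfolding h_def using that by (intro prod.mono_neutral_left) (auto simp: in_keys_iff)
  have h: "h (m + m') = h m * h m'" for m m'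
  proof -
    let ?V = "Poly_Mapping.keys m \<union> Poly_Mapping.keys m'"
    have "h (m + m') = (\<Prod>v\<in>?V. t v ^ Poly_Mapping.lookup (m + m') v)"
      by (rule sup) (use Poly_Mapping.keys_add[of m m'] in auto)
    then show ?thesis
      by (simp add: sup[of ?V] lookup_add power_add prod.distrib)
  qed
  have ins: "insertion t = lin_eval h"
    unfolding insertion_def h_def[abs_def] ..
  show ?thesis unfolding ins
  proof (induction P rule: poly_mapping_induct_add)
    case zero
    show ?case by simp
  next
    case (single m c)
    show ?case
      by (induction Q rule: poly_mapping_induct_add)
         (simp_all add: mult_single lin_eval_single h lin_eval_add algebra_simps)
  next
    case (add P P')
    then show ?case by (simp add: lin_eval_add distrib_right)
  qed
qed

lemma insertion_Var: "insertion t (Var v) = t v"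
  by (simp add: insertion_def Var_def lin_eval_single)

lemma insertion_sym_ideal:
  assumes "P \<in> sym_ideal"
  shows "insertion (\<lambda>v. tr v p) P = 0"
  using assms unfolding sym_ideal_def
proof (induction rule: module.span_induct_alt[OF module_times, consumes 1, case_names base step])
  case base
  show ?case by (simp add: insertion_def)
next
  case (step S R P)
  have lin: "insertion t (P + Q) = insertion t P + insertion t Q"
      "insertion t (P - Q) = insertion t P - insertion t Q"
      "insertion t (c \<cdot> P) = c * insertion t P" for t c and P Q :: "cyc cpoly"
    by (simp_all add: insertion_def lin_eval_add lin_eval_diff lin_eval_scal)
  have "insertion (\<lambda>v. tr v p) R = 0"
    using step by (auto simp: lin insertion_Var tr_linear)
  with step show ?case by (simp add: lin insertion_mult)
qed

text \<open>The algebra homomorphism from \<open>S(A / [A, A])\<close> to the ring of invariants extending \<^const>\<open>tr\<close>.\<close>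

lift_definition tr_hom :: "sym_cyc \<Rightarrow> 'n::finite rep \<Rightarrow> complex"
  is "\<lambda>P p. insertion (\<lambda>v. tr v p) P"
proof
  fix P Q :: "cyc cpoly" and p :: "'n rep"
  assume "P - Q \<in> sym_ideal"
  from insertion_sym_ideal[OF this, of p]
  show "insertion (\<lambda>v. tr v p) P = insertion (\<lambda>v. tr v p) Q"
    by (simp add: insertion_def lin_eval_diff)
qed

section \<open>The Poisson bracket on the invariants\<close>

text \<open>The bracket of two invariants is the image of the Lie-Poisson bracket of preimages under
  \<^const>\<open>tr_hom\<close>. Preimages exist because the invariants are generated by traces of words, and the
  result does not depend on their choice because the kernel of \<^const>\<open>tr_hom\<close> is a Poisson ideal.\<close>

definition iss_bracket ::
    "('n::finite rep \<Rightarrow> complex) \<Rightarrow> ('n rep \<Rightarrow> complex) \<Rightarrow> ('n rep \<Rightarrow> complex)"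
  where "iss_bracket f g = tr_hom (lie_poisson (SOME F. tr_hom F = f) (SOME G. tr_hom G = g))"

definition poisson_center :: "'a set \<Rightarrow> ('a \<Rightarrow> 'a \<Rightarrow> 'a::zero) \<Rightarrow> 'a set"
  where "poisson_center R br = {f \<in> R. \<forall>g\<in>R. br f g = 0}"

definition PH0_iss :: "('n::finite rep \<Rightarrow> complex) set"
  where "PH0_iss = poisson_center coord_ring_iss iss_bracket"

text \<open>For a subspace \<open>V\<close>, such as a Poisson center, this says that \<open>V\<close> has no finite spanning set.\<close>

definition infinite_dimensional :: "('a \<Rightarrow> complex) set \<Rightarrow> bool"
  where "infinite_dimensional V \<longleftrightarrow>
    (\<nexists>B. finite B \<and> V \<subseteq> module.span (\<lambda>c f x. c * f x) B)"

end

theory Submission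
  imports Defs
begin

text \<open>The bracket with an invariant \<open>g\<close> is differentiation along its Hamiltonian vector field on
  \<open>M\<^sub>n \<oplus> M\<^sub>n\<close>, which is given by the cyclic derivatives of \<open>g\<close>. This vector field is tangent to the
  fibres of the moment map \<open>(x, x\<^sup>*) \<mapsto> x x\<^sup>* - x\<^sup>* x\<close>, so the invariant \<open>tr ((x x\<^sup>* - x\<^sup>* x)\<^sup>2)\<close> and its powers
  are central. For \<open>n \<ge> 2\<close> this invariant takes every complex value, hence its powers are linearly
  independent.

  The bracket is computed with chosen preimages under \<^const>\<open>tr_hom\<close>. As centrality is shown for
  every element \<open>G\<close> in place of the preimage of \<open>g\<close>, it does not matter whether \<open>SOME\<close> finds one.\<close>

section \<open>Matrices depending on a parameter\<close>

definition scale_mat :: "complex \<Rightarrow> complex^'n^'m \<Rightarrow> complex^'n^'m" (infixr "*\<^sub>m" 75)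
  where "c *\<^sub>m M = (\<chi> i j. c * M $ i $ j)"

lemma scale_mat_nth [simp]: "(c *\<^sub>m M) $ i $ j = c * M $ i $ j"
  by (simp add: scale_mat_def)

lemma scale_mat_zero [simp]: "0 *\<^sub>m M = 0" "c *\<^sub>m 0 = 0"
  by (simp_all add: vec_eq_iff)

lemma scale_mat_add: "c *\<^sub>m (M + N) = c *\<^sub>m M + c *\<^sub>m N"
  by (simp add: vec_eq_iff algebra_simps)

lemma scale_mat_diff: "c *\<^sub>m (M - N) = c *\<^sub>m M - c *\<^sub>m N"
  by (simp add: vec_eq_iff algebra_simps)

lemma scale_mat_mult_left: "(c *\<^sub>m M) ** N = c *\<^sub>m (M ** N)"
  by (simp add: vec_eq_iff matrix_matrix_mult_def sum_distrib_left mult_ac)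

lemma scale_mat_mult_right: "M ** (c *\<^sub>m N) = c *\<^sub>m (M ** N)"
  by (simp add: vec_eq_iff matrix_matrix_mult_def sum_distrib_left mult_ac)

lemma matrix_add_distrib_right: "(A + B) ** C = A ** C + B ** C"
  for A B :: "complex^'n^'m"
  by (simp add: vec_eq_iff matrix_matrix_mult_def distrib_right sum.distrib)

lemma matrix_mult_zero [simp]: "0 ** N = 0" "M ** 0 = 0" for M N :: "complex^'n^'m"
  by (simp_all add: vec_eq_iff matrix_matrix_mult_def)

lemma matrix_mult_sum_left: "sum F I ** N = (\<Sum>i\<in>I. F i ** N)"
  for N :: "complex^'n^'m"
  by (induction I rule: infinite_finite_induct) (simp_all add: matrix_add_distrib_right)

lemma matrix_mult_sum_right: "N ** sum F I = (\<Sum>i\<in>I. N ** F i)"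
  for N :: "complex^'n^'m"
  by (induction I rule: infinite_finite_induct) (simp_all add: matrix_add_ldistrib)

lemma matrix_diff_distrib:
  "(A - B) ** C = A ** C - B ** C" "C' ** (A - B) = C' ** A - C' ** B"
  for A B :: "complex^'n^'m"
  by (simp_all add: vec_eq_iff matrix_matrix_mult_def algebra_simps sum_subtractf)

lemma trace_scale_mat: "trace (c *\<^sub>m M) = c * trace M"
  by (simp add: trace_def sum_distrib_left)

lemma trace_zero [simp]: "trace (0 :: complex^'n^'n) = 0"
  by (simp add: trace_def)

lemma trace_sum: "trace (sum F I) = (\<Sum>i\<in>I. trace (F i))" for F :: "'i \<Rightarrow> complex^'n^'n"
  by (induction I rule: infinite_finite_induct) (simp_all add: trace_add)

text \<open>Entrywise complex derivative, taken only at parameter 0: every curve below is a line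
  that reaches the point of interest there.\<close>

definition has_matrix_derivative :: "(complex \<Rightarrow> complex^'n^'m) \<Rightarrow> complex^'n^'m \<Rightarrow> bool"
  where "has_matrix_derivative M D \<longleftrightarrow> (\<forall>i j. ((\<lambda>t. M t $ i $ j) has_field_derivative D $ i $ j) (at 0))"

lemma has_matrix_derivative_mult:
  assumes "has_matrix_derivative M D" "has_matrix_derivative N E"
  shows "has_matrix_derivative (\<lambda>t. M t ** N t) (D ** N 0 + M 0 ** E)"
  unfolding has_matrix_derivative_def
proof (intro allI)
  fix i j
  have "((\<lambda>t. \<Sum>k\<in>UNIV. M t $ i $ k * N t $ k $ j) has_field_derivative
      (\<Sum>k\<in>UNIV. M 0 $ i $ k * E $ k $ j + D $ i $ k * N 0 $ k $ j)) (at 0)"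
    using assms unfolding has_matrix_derivative_def by (intro DERIV_sum DERIV_mult') auto
  then show "((\<lambda>t. (M t ** N t) $ i $ j) has_field_derivative (D ** N 0 + M 0 ** E) $ i $ j) (at 0)"
    by (simp add: matrix_matrix_mult_def sum.distrib add.commute)
qed

lemma has_matrix_derivative_diff:
  assumes "has_matrix_derivative M D" "has_matrix_derivative N E"
  shows "has_matrix_derivative (\<lambda>t. M t - N t) (D - E)"
  using assms by (simp add: has_matrix_derivative_def DERIV_diff)

lemma has_matrix_derivative_line: "has_matrix_derivative (\<lambda>t. M + t *\<^sub>m D) D"
  unfolding has_matrix_derivative_def by (auto intro!: derivative_eq_intros)

lemma has_matrix_derivative_trace:
  assumes "has_matrix_derivative M D"
  shows "((\<lambda>t. trace (M t)) has_field_derivative trace D) (at 0)"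
  using assms unfolding has_matrix_derivative_def trace_def by (intro DERIV_sum) auto

section \<open>Hamiltonian directions\<close>

text \<open>Directions are indexed by generators, so both coordinates are treated uniformly when
  words are differentiated.\<close>

definition line :: "'n::finite rep \<Rightarrow> (gen \<Rightarrow> complex^'n^'n) \<Rightarrow> complex \<Rightarrow> 'n rep"
  where "line p V t = (fst p + t *\<^sub>m V X, snd p + t *\<^sub>m V Xstar)"

lemma line_zero [simp]: "line p V 0 = p"
  by (simp add: line_def)

lemma eval_gen_line: "eval_gen (line p V t) g = eval_gen p g + t *\<^sub>m V g"
  by (cases g) (simp_all add: line_def)

lemma eval_word_Nil: "eval_word p (Word []) = mat 1"
  by (simp add: eval_word_def)

lemma eval_word_Cons: "eval_word p (Word (g # gs)) = eval_gen p g ** eval_word p (Word gs)"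
  by (simp add: eval_word_def)

lemma eval_word_append:
  "eval_word p (Word (gs @ hs)) = eval_word p (Word gs) ** eval_word p (Word hs)"
  using eval_word_add[of p "Word gs" "Word hs"] by (simp add: plus_word_def)

text \<open>The noncommutative product rule written out: each letter in turn is replaced by its
  component of the direction.\<close>

definition deriv_word :: "'n::finite rep \<Rightarrow> (gen \<Rightarrow> complex^'n^'n) \<Rightarrow> gen list \<Rightarrow> complex^'n^'n"
  where "deriv_word p V gs = (\<Sum>i<length gs.
    eval_word p (Word (take i gs)) ** V (gs ! i) ** eval_word p (Word (drop (Suc i) gs)))"

lemma deriv_word_Cons:
  "deriv_word p V (g # gs) = V g ** eval_word p (Word gs) + eval_gen p g ** deriv_word p V gs"
  by (simp only: deriv_word_def sum.lessThan_Suc_shift length_Cons)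
     (simp add: eval_word_Nil eval_word_Cons matrix_mult_sum_right matrix_mul_assoc)

lemma has_matrix_derivative_eval_word:
  "has_matrix_derivative (\<lambda>t. eval_word (line p V t) (Word gs)) (deriv_word p V gs)"
proof (induction gs)
  case Nil
  show ?case by (simp add: eval_word_Nil deriv_word_def has_matrix_derivative_def)
next
  case (Cons g gs)
  have "has_matrix_derivative (\<lambda>t. eval_gen (line p V t) g) (V g)"
    unfolding eval_gen_line by (rule has_matrix_derivative_line)
  from has_matrix_derivative_mult[OF this Cons] show ?case
    by (simp add: eval_word_Cons deriv_word_Cons)
qed

text \<open>Linearity in the direction, which carries results for Hamiltonians of single words over
  to combinations of them.\<close>

lemma deriv_word_sum:
  "deriv_word p (\<lambda>g. \<Sum>k\<in>K. c k *\<^sub>m W k g) gs = (\<Sum>k\<in>K. c k *\<^sub>m deriv_word p (W k) gs)"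
proof (induction gs)
  case Nil
  show ?case by (simp add: deriv_word_def)
next
  case (Cons g gs)
  then show ?case
    by (simp add: deriv_word_Cons matrix_mult_sum_left matrix_mult_sum_right scale_mat_mult_left
        scale_mat_mult_right scale_mat_add sum.distrib)
qed

definition deriv_trace :: "'n::finite rep \<Rightarrow> (gen \<Rightarrow> complex^'n^'n) \<Rightarrow> falg \<Rightarrow> complex"
  where "deriv_trace p V = lin_eval (\<lambda>w. trace (deriv_word p V (letters w)))"

lemma DERIV_trace_falg:
  "((\<lambda>t. trace_falg (line p V t) a) has_field_derivative deriv_trace p V a) (at 0)"
proof -
  have "((\<lambda>t. trace (eval_word (line p V t) w)) has_field_derivative
      trace (deriv_word p V (letters w))) (at 0)" for w
    using has_matrix_derivative_trace[OF has_matrix_derivative_eval_word[of p V "letters w"]] by simp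
  then show ?thesis
    unfolding trace_falg_def deriv_trace_def lin_eval_def by (intro DERIV_sum DERIV_cmult)
qed

lemma deriv_trace_sum:
  "deriv_trace p (\<lambda>g. \<Sum>k\<in>K. c k *\<^sub>m W k g) a = (\<Sum>k\<in>K. c k * deriv_trace p (W k) a)"
  unfolding deriv_trace_def lin_eval_def deriv_word_sum trace_sum trace_scale_mat sum_distrib_left
  by (subst sum.swap) (simp add: mult_ac)

section \<open>Cyclic derivatives and the Hamiltonian direction\<close>

text \<open>The \<open>X\<close> component is the cyclic derivative of \<open>v\<close> by
  \<open>Xstar\<close>, the \<open>Xstar\<close> component is minus the one by \<open>X\<close>,
  both evaluated at \<open>p\<close>. Deleting a letter leaves the part after it times the part
  before it.\<close>

definition ham_word :: "'n::finite rep \<Rightarrow> word \<Rightarrow> gen \<Rightarrow> complex^'n^'n"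
  where "ham_word p v g = (\<Sum>j<length (letters v). gen_sign g (letters v ! j) *\<^sub>m
    (eval_word p (Word (drop (Suc j) (letters v))) ** eval_word p (Word (take j (letters v)))))"

definition ham :: "'n::finite rep \<Rightarrow> falg \<Rightarrow> gen \<Rightarrow> complex^'n^'n"
  where "ham p b g = (\<Sum>v\<in>Poly_Mapping.keys b. Poly_Mapping.lookup b v *\<^sub>m ham_word p v g)"

text \<open>Uniqueness of the canonical double bracket makes the explicit formula on words available
  for computation.\<close>

lemma dbr_eq_formula: "dbr = dbr_formula"
  using canonical_double_bracket_unique[OF canonical_dbr canonical_dbr_formula] .

lemma trace_falg_sum: "trace_falg p (sum f I) = (\<Sum>i\<in>I. trace_falg p (f i))"
  by (induction I rule: infinite_finite_induct) (simp_all add: trace_falg_def lin_eval_add)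

lemma trace_falg_scal: "trace_falg p (c \<cdot> a) = c * trace_falg p a"
  by (simp add: trace_falg_def lin_eval_scal)

lemma mu_sum: "mu (sum f I) = (\<Sum>i\<in>I. mu (f i))"
  by (simp add: mu_def lin_sum)

lemma trace_mu_single:
  "trace_falg p (mu (Poly_Mapping.single (u, v) c)) = c * trace (eval_word p u ** eval_word p v)"
  by (simp add: mu_def lin_single mult_single trace_falg_def lin_eval_single eval_word_add)

text \<open>Cyclicity of the trace moves the two pieces of \<open>v\<close> together into the gap
  left by the deleted letter of \<open>u\<close>. Summing over the letters of \<open>v\<close> fills
  that gap with the Hamiltonian component.\<close>

lemma trace_word_dbr:
  "trace_falg p (mu (word_dbr u v)) = trace (deriv_word p (ham_word p v) (letters u))"
proof -
  let ?u = "letters u" and ?v = "letters v" and ?e = "\<lambda>gs. eval_word p (Word gs)"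
  have cyc: "trace (?e (take j ?v) ** ?e (drop (Suc i) ?u) ** (?e (take i ?u) ** ?e (drop (Suc j) ?v)))
      = trace (?e (take i ?u) ** (?e (drop (Suc j) ?v) ** ?e (take j ?v)) ** ?e (drop (Suc i) ?u))" for i j
    by (subst trace_mul_sym) (simp add: matrix_mul_assoc)
  have "trace_falg p (mu (word_dbr u v)) = (\<Sum>i<length ?u. \<Sum>j<length ?v. gen_sign (?u ! i) (?v ! j) *
     trace (?e (take j ?v) ** ?e (drop (Suc i) ?u) ** (?e (take i ?u) ** ?e (drop (Suc j) ?v))))"
    by (simp add: word_dbr_def mu_sum trace_falg_sum trace_mu_single eval_word_append)
  also have "\<dots> = trace (deriv_word p (ham_word p v) ?u)"
    unfolding cyc deriv_word_def ham_word_def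
    by (simp add: trace_sum matrix_mult_sum_left matrix_mult_sum_right scale_mat_mult_left
        scale_mat_mult_right trace_scale_mat)
  finally show ?thesis .
qed

lemma trace_dbr: "trace_falg p (mu (dbr a b)) = deriv_trace p (ham p b) a"
proof -
  have "trace_falg p (mu (dbr a b)) = (\<Sum>u\<in>Poly_Mapping.keys a. Poly_Mapping.lookup a u *
      (\<Sum>v\<in>Poly_Mapping.keys b. Poly_Mapping.lookup b v * trace_falg p (mu (word_dbr u v))))"
    by (simp add: dbr_eq_formula dbr_formula_def lin_def mu_sum mu_scal trace_falg_sum trace_falg_scal)
  then show ?thesis
    by (simp add: deriv_trace_def lin_eval_def ham_def[abs_def] deriv_word_sum trace_sum
        trace_scale_mat trace_word_dbr)
qed

section \<open>The moment map\<close>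

definition moment :: "'n::finite rep \<Rightarrow> complex^'n^'n"
  where "moment p = fst p ** snd p - snd p ** fst p"

definition deriv_moment :: "'n::finite rep \<Rightarrow> (gen \<Rightarrow> complex^'n^'n) \<Rightarrow> complex^'n^'n"
  where "deriv_moment p V =
    (V X ** snd p + fst p ** V Xstar) - (V Xstar ** fst p + snd p ** V X)"

lemma has_matrix_derivative_moment:
  "has_matrix_derivative (\<lambda>t. moment (line p V t)) (deriv_moment p V)"
proof -
  have "has_matrix_derivative (\<lambda>t. fst (line p V t)) (V X)"
      "has_matrix_derivative (\<lambda>t. snd (line p V t)) (V Xstar)"
    unfolding line_def fst_conv snd_conv by (rule has_matrix_derivative_line)+
  then have "has_matrix_derivative (\<lambda>t. moment (line p V t))
      ((V X ** snd (line p V 0) + fst (line p V 0) ** V Xstar)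
        - (V Xstar ** fst (line p V 0) + snd (line p V 0) ** V X))"
    unfolding moment_def by (intro has_matrix_derivative_diff has_matrix_derivative_mult)
  then show ?thesis by (simp add: deriv_moment_def)
qed

lemma deriv_moment_sum:
  "deriv_moment p (\<lambda>g. \<Sum>k\<in>K. c k *\<^sub>m W k g) = (\<Sum>k\<in>K. c k *\<^sub>m deriv_moment p (W k))"
  by (simp add: deriv_moment_def matrix_mult_sum_left matrix_mult_sum_right scale_mat_mult_left
      scale_mat_mult_right scale_mat_add scale_mat_diff sum.distrib sum_subtractf)

text \<open>The sum of the commutators of the generators with the cyclic derivatives of a word telescopes
  around the word.\<close>

lemma deriv_moment_ham_word: "deriv_moment p (ham_word p v) = 0"
proof -
  let ?v = "letters v" and ?e = "\<lambda>gs. eval_word p (Word gs)"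
  \<comment> \<open>\<open>R j\<close> is the value of \<open>v\<close> rotated to start at letter
    \<open>j\<close>, and \<open>c j\<close> is the same with that letter deleted. Multiplying
    \<open>c j\<close> by the letter on the right gives \<open>R (Suc j)\<close>, on the left
    \<open>R j\<close>.\<close>
  define R where "R j = ?e (drop j ?v) ** ?e (take j ?v)" for j
  define c where "c j = ?e (drop (Suc j) ?v) ** ?e (take j ?v)" for j
  have sum_form: "deriv_moment p (ham_word p v) = (\<Sum>j<length ?v.
      (gen_sign X (?v ! j) *\<^sub>m c j ** snd p + fst p ** (gen_sign Xstar (?v ! j) *\<^sub>m c j))
      - (gen_sign Xstar (?v ! j) *\<^sub>m c j ** fst p + snd p ** (gen_sign X (?v ! j) *\<^sub>m c j)))"
    by (simp add: deriv_moment_def ham_word_def c_def matrix_mult_sum_left matrix_mult_sum_right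
        sum.distrib sum_subtractf)
  also have "\<dots> = (\<Sum>j<length ?v. R (Suc j) - R j)"
  proof (rule sum.cong[OF refl])
    fix j assume "j \<in> {..<length ?v}"
    then have j: "j < length ?v" by simp
    have take: "?e (take (Suc j) ?v) = ?e (take j ?v) ** eval_gen p (?v ! j)"
      using j by (simp add: take_Suc_conv_app_nth eval_word_append eval_word_Cons eval_word_Nil)
    have drop: "?e (drop j ?v) = eval_gen p (?v ! j) ** ?e (drop (Suc j) ?v)"
      using j by (simp add: Cons_nth_drop_Suc[symmetric] eval_word_Cons)
    have "R (Suc j) - R j = c j ** eval_gen p (?v ! j) - eval_gen p (?v ! j) ** c j"
      by (simp add: R_def c_def take drop matrix_mul_assoc)
    moreover have "1 *\<^sub>m M = M" "(-1) *\<^sub>m M = - M" for M :: "complex^'a^'a"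
      by (simp_all add: vec_eq_iff)
    moreover have "M ** (- N) = - (M ** N)" "(- M) ** N = - (M ** N)" for M N :: "complex^'a^'a"
      by (simp_all add: vec_eq_iff matrix_matrix_mult_def sum_negf)
    ultimately show "(gen_sign X (?v ! j) *\<^sub>m c j ** snd p + fst p ** (gen_sign Xstar (?v ! j) *\<^sub>m c j))
        - (gen_sign Xstar (?v ! j) *\<^sub>m c j ** fst p + snd p ** (gen_sign X (?v ! j) *\<^sub>m c j))
        = R (Suc j) - R j"
      by (cases "?v ! j") (simp_all)
  qed
  also have "\<dots> = R (length ?v) - R 0"
    by (rule sum_lessThan_telescope)
  \<comment> \<open>Rotation by the full length and by 0 both give back \<open>v\<close>.\<close>
  also have "\<dots> = 0"
    by (simp add: R_def eval_word_Nil)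
  finally show ?thesis .
qed

lemma deriv_moment_ham: "deriv_moment p (ham p b) = 0"
  by (simp add: ham_def[abs_def] deriv_moment_sum deriv_moment_ham_word)

section \<open>The Lie-Poisson bracket as a directional derivative\<close>

lemma insertion_add: "insertion t (P + Q) = insertion t P + insertion t Q"
  by (simp add: insertion_def lin_eval_add)

lemma insertion_single_zero: "insertion t (Poly_Mapping.single 0 c) = c"
  by (simp add: insertion_def lin_eval_single)

lemma insertion_one: "insertion t 1 = 1"
  using insertion_single_zero[of t 1] by simp

lemma insertion_sum: "insertion t (sum f I) = (\<Sum>i\<in>I. insertion t (f i))"
  by (induction I rule: infinite_finite_induct) (simp_all add: insertion_def lin_eval_add)

lemma insertion_power: "insertion t (P ^ k) = insertion t P ^ k"
  by (induction k) (simp_all add: insertion_mult insertion_one)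

text \<open>Constants and variables generate the polynomial ring. This form of induction suits
  identities between two maps that both obey the product rule.\<close>

lemma cpoly_induct [case_names const Var add mult]:
  fixes P :: "'v cpoly"
  assumes const: "\<And>c. S (Poly_Mapping.single 0 c)" and Var: "\<And>v. S (Var v)"
    and add: "\<And>P Q. S P \<Longrightarrow> S Q \<Longrightarrow> S (P + Q)" and mult: "\<And>P Q. S P \<Longrightarrow> S Q \<Longrightarrow> S (P * Q)"
  shows "S P"
proof -
  have one: "S 1" using const[of 1] by simp
  have monom: "S (basis m)" for m :: "'v \<Rightarrow>\<^sub>0 nat"
  proof (induction m rule: poly_mapping_induct_add)
    case zero
    show ?case using one by simp
  next
    case (single v k)
    have "S (Var v ^ k)"
      by (induction k) (simp_all add: one mult Var)
    moreover have "Var v ^ k = basis (Poly_Mapping.single v k)"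
      by (induction k) (simp_all add: Var_def mult_single flip: single_add)
    ultimately show ?case by simp
  next
    case (add a b)
    from mult[OF add] show ?case by (simp add: mult_single)
  qed
  show ?thesis
  proof (induction P rule: poly_mapping_induct_add)
    case zero
    show ?case using const[of 0] by simp
  next
    case (single m c)
    from mult[OF const[of c] monom[of m]] show ?case by (simp add: mult_single)
  qed (rule add)
qed

lemma lie_poisson_poly_const: "lie_poisson_poly br (Poly_Mapping.single 0 c) Q = 0"
proof -
  have "vars (Poly_Mapping.single 0 c :: 'a cpoly) = {}"
    by (simp add: vars_def)
  then show ?thesis by (simp add: lie_poisson_poly_def)
qed

text \<open>Since the direction does not depend on \<open>F\<close>, the value of the bracket depends on \<open>F\<close> only through
  the function it induces; this replaces the statement that the kernel of \<^const>\<open>tr_hom\<close> is a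
  Poisson ideal.\<close>

lemma lie_poisson_directional_derivative:
  fixes p :: "'n::finite rep"
  obtains V where "deriv_moment p V = 0"
    and "\<And>F. ((\<lambda>t. tr_hom F (line p V t)) has_field_derivative tr_hom (lie_poisson F G) p) (at 0)"
proof -
  define Q where "Q = rep_sym_cyc G"
  have G: "G = abs_sym_cyc Q"
    using Quotient3_abs_rep[OF Quotient3_sym_cyc] by (simp add: Q_def)
  \<comment> \<open>Chain rule: the Hamiltonian direction of a polynomial in traces is the sum of
    those of its variables, weighted by its partial derivatives at the trace values.\<close>
  define c where "c v = insertion (\<lambda>u. tr u p) (pd v Q)" for v
  define V where "V g = (\<Sum>v\<in>vars Q. c v *\<^sub>m ham p (rep_cyc v) g)" for g
  have var: "((\<lambda>t. tr u (line p V t)) has_field_derivative (\<Sum>v\<in>vars Q. c v * tr (lie u v) p)) (at 0)" for u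
  proof -
    have rep: "abs_cyc (rep_cyc w) = w" for w
      using Quotient3_abs_rep[OF Quotient3_cyc] .
    have "tr u q = trace_falg q (rep_cyc u)" for q :: "'n rep"
      using tr.abs_eq[of "rep_cyc u"] rep by metis
    moreover have "tr (lie u v) p = deriv_trace p (ham p (rep_cyc v)) (rep_cyc u)" for v
      using lie.abs_eq[of "rep_cyc u" "rep_cyc v"] by (simp add: rep tr.abs_eq trace_dbr)
    moreover have "deriv_trace p V (rep_cyc u) =
        (\<Sum>v\<in>vars Q. c v * deriv_trace p (ham p (rep_cyc v)) (rep_cyc u))"
      unfolding V_def[abs_def] by (rule deriv_trace_sum)
    ultimately show ?thesis
      using DERIV_trace_falg[of p V "rep_cyc u"] by simp
  qed
  \<comment> \<open>Both sides obey the sum and product rules in \<open>P\<close>, so the case of a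
    single variable, settled by \<open>var\<close>, decides the claim.\<close>
  have poly: "((\<lambda>t. insertion (\<lambda>v. tr v (line p V t)) P) has_field_derivative
      insertion (\<lambda>v. tr v p) (lie_poisson_poly lie P Q)) (at 0)" for P
  proof (induction P rule: cpoly_induct)
    case (const a)
    show ?case by (simp add: insertion_single_zero lie_poisson_poly_const) (simp add: insertion_def)
  next
    case (Var u)
    show ?case using var[of u]
      by (simp add: insertion_Var lie_poisson_poly_Var_left insertion_sum insertion_mult c_def)
  next
    case (add P P')
    from DERIV_add[OF add] show ?case by (simp add: insertion_add lie_poisson_poly_add_left)
  next
    case (mult P P')
    from DERIV_mult'[OF mult] show ?case
      by (simp add: insertion_mult insertion_add lie_poisson_poly_mult_left mult_ac add_ac)
  qed
  have "deriv_moment p V = 0"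
    unfolding V_def[abs_def] deriv_moment_sum by (simp add: deriv_moment_ham)
  moreover have "((\<lambda>t. tr_hom F (line p V t)) has_field_derivative tr_hom (lie_poisson F G) p) (at 0)" for F
  proof -
    have F: "F = abs_sym_cyc (rep_sym_cyc F)"
      using Quotient3_abs_rep[OF Quotient3_sym_cyc] by simp
    show ?thesis
      unfolding G by (subst (1 2) F) (simp only: lie_poisson.abs_eq tr_hom.abs_eq poly)
  qed
  ultimately show ?thesis using that by blast
qed

section \<open>Central invariants\<close>

text \<open>The moment map is a commutator and has trace 0, so its square is the first power whose
  trace can be nonzero.\<close>

definition casimir :: "'n::finite rep \<Rightarrow> complex"
  where "casimir p = trace (moment p ** moment p)"

text \<open>Exhibits a preimage, so that \<open>SOME\<close> in \<open>iss_bracket\<close> picks a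
  genuine one for the first argument.\<close>

lemma casimir_power_eq_tr_hom: "\<exists>F. (tr_hom F :: 'n::finite rep \<Rightarrow> complex) = (\<lambda>p. casimir p ^ k)"
proof -
  define d where "d = gen_x * gen_xstar - gen_xstar * gen_x"
  let ?x = "Word [X]" and ?y = "Word [Xstar]"
  have dd: "d * d = basis (?x + ?y + (?x + ?y)) - basis (?x + ?y + (?y + ?x))
      - basis (?y + ?x + (?x + ?y)) + basis (?y + ?x + (?y + ?x))"
    by (simp add: d_def gen_x_def gen_xstar_def algebra_simps mult_single)
  have "tr (abs_cyc (d * d)) p = casimir p" for p :: "'n rep"
    unfolding tr.abs_eq trace_falg_def dd lin_eval_diff lin_eval_add lin_eval_single
      eval_word_add casimir_def moment_def
    by (simp add: eval_word_def matrix_diff_distrib trace_sub trace_add algebra_simps)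
  then have "tr_hom (abs_sym_cyc (Var (abs_cyc (d * d)) ^ k)) = (\<lambda>p :: 'n rep. casimir p ^ k)"
    unfolding tr_hom.abs_eq by (simp add: insertion_power insertion_Var)
  then show ?thesis by blast
qed

section \<open>The invariant is a polynomial function fixed by conjugation\<close>

lemma coord_ring_rep_sum:
  "(\<And>i. i \<in> I \<Longrightarrow> f i \<in> coord_ring_rep) \<Longrightarrow> (\<lambda>p. \<Sum>i\<in>I. f i p) \<in> coord_ring_rep"
proof (induction I rule: infinite_finite_induct)
  case (insert i I)
  then have "f i + (\<lambda>p. \<Sum>i\<in>I. f i p) \<in> coord_ring_rep"
    by (intro coord_ring_rep.add) auto
  with insert.hyps show ?case by (simp add: plus_fun_def)
qed (simp_all add: coord_ring_rep.const)

lemma coord_ring_rep_mult: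
  "f \<in> coord_ring_rep \<Longrightarrow> g \<in> coord_ring_rep \<Longrightarrow> (\<lambda>p. f p * g p) \<in> coord_ring_rep"
  using coord_ring_rep.mult[of f g] by (simp add: times_fun_def)

lemma coord_ring_rep_diff:
  assumes "f \<in> coord_ring_rep" "g \<in> coord_ring_rep"
  shows "(\<lambda>p. f p - g p) \<in> coord_ring_rep"
  using coord_ring_rep.add[OF assms(1) coord_ring_rep_mult[OF coord_ring_rep.const[of "-1"] assms(2)]]
  by (simp add: plus_fun_def)

lemma coord_ring_rep_power: "f \<in> coord_ring_rep \<Longrightarrow> (\<lambda>p. f p ^ k) \<in> coord_ring_rep"
  by (induction k) (simp_all add: coord_ring_rep.const coord_ring_rep_mult)

lemma casimir_coord_ring_rep: "(casimir :: 'n::finite rep \<Rightarrow> complex) \<in> coord_ring_rep"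
proof -
  have "(\<lambda>p :: 'n::finite rep. moment p $ i $ j) \<in> coord_ring_rep" for i j
    unfolding moment_def vector_minus_component matrix_matrix_mult_def vec_lambda_beta
    by (intro coord_ring_rep_diff coord_ring_rep_sum coord_ring_rep_mult
        coord_ring_rep.entry_x coord_ring_rep.entry_xstar)
  then have "(\<lambda>p :: 'n::finite rep. \<Sum>i\<in>UNIV. \<Sum>j\<in>UNIV. moment p $ i $ j * moment p $ j $ i) \<in> coord_ring_rep"
    by (intro coord_ring_rep_sum coord_ring_rep_mult)
  then show ?thesis
    by (simp add: casimir_def[abs_def] trace_def matrix_matrix_mult_def)
qed

text \<open>The moment map is equivariant for conjugation, and the trace is invariant under
  it.\<close>

lemma casimir_gl_act:
  assumes "invertible g"
  shows "casimir (gl_act g p) = casimir p"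
proof -
  let ?h = "matrix_inv g"
  have inv: "?h ** g = mat 1" using someI_ex[OF assms[unfolded invertible_def]] by (simp add: matrix_inv_def)
  have conj: "(g ** A ** ?h) ** (g ** B ** ?h) = g ** (A ** B) ** ?h" for A B
  proof -
    have "(g ** A ** ?h) ** (g ** B ** ?h) = g ** A ** (?h ** g) ** B ** ?h"
      by (simp only: matrix_mul_assoc)
    then show ?thesis by (simp add: inv matrix_mul_assoc)
  qed
  have "moment (gl_act g p) = g ** moment p ** ?h"
    by (simp add: moment_def gl_act_def conj matrix_diff_distrib)
  then have "casimir (gl_act g p) = trace (g ** (moment p ** moment p) ** ?h)"
    by (simp add: casimir_def conj)
  also have "\<dots> = trace (?h ** (g ** (moment p ** moment p)))"
    by (rule trace_mul_sym)
  also have "\<dots> = casimir p"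
    by (simp add: matrix_mul_assoc inv casimir_def)
  finally show ?thesis .
qed

text \<open>The bracket at \<open>p\<close> is a derivative along a direction in which the moment
  map is stationary, so any power of \<open>casimir\<close> has derivative 0 there. Uniqueness of
  derivatives gives the vanishing.\<close>

lemma casimir_power_in_PH0: "(\<lambda>p :: 'n::finite rep. casimir p ^ k) \<in> PH0_iss"
proof -
  let ?f = "\<lambda>p :: 'n rep. casimir p ^ k"
  have "?f \<in> coord_ring_iss"
    by (simp add: coord_ring_iss_def coord_ring_rep_power casimir_coord_ring_rep casimir_gl_act)
  moreover have "iss_bracket ?f g = 0" for g
  proof
    fix p :: "'n rep"
    define F G where "F = (SOME F. tr_hom F = ?f)" and "G = (SOME G. tr_hom G = g)"
    have F: "tr_hom F = ?f"
      unfolding F_def by (rule someI_ex[OF casimir_power_eq_tr_hom])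
    obtain V where V: "deriv_moment p V = 0"
      and D: "((\<lambda>t. tr_hom F (line p V t)) has_field_derivative tr_hom (lie_poisson F G) p) (at 0)"
      using lie_poisson_directional_derivative[of p G] by blast
    note M = has_matrix_derivative_moment[of p V, unfolded V]
    have "((\<lambda>t. casimir (line p V t)) has_field_derivative 0) (at 0)"
      using has_matrix_derivative_trace[OF has_matrix_derivative_mult[OF M M]]
      by (simp add: casimir_def)
    from DERIV_power[OF this, of k]
    have "((\<lambda>t. tr_hom F (line p V t)) has_field_derivative 0) (at 0)"
      by (simp add: F)
    from DERIV_unique[OF D this] show "iss_bracket ?f g p = 0 p"
      by (simp add: iss_bracket_def F_def G_def)
  qed
  ultimately show ?thesis
    by (simp add: PH0_iss_def poisson_center_def)
qed

section \<open>Infinitely many independent central elements\<close>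

lemma surj_casimir:
  assumes "CARD('n::finite) \<ge> 2"
  shows "surj (casimir :: 'n rep \<Rightarrow> complex)"
proof -
  obtain a b :: 'n where ab: "a \<noteq> b"
    using assms by (metis One_nat_def card_le_Suc0_iff_eq finite not_less_eq_eq numeral_2_eq_2 UNIV_I)
  define E :: "'n \<Rightarrow> 'n \<Rightarrow> complex^'n^'n" where "E i j = (\<chi> k l. if k = i \<and> l = j then 1 else 0)" for i j
  have E: "E i j ** E k l = (if j = k then E i l else 0)" for i j k l
    by (auto simp: E_def vec_eq_iff matrix_matrix_mult_def if_distrib[of "\<lambda>x. x * _"] if_distrib[of "(*) _"]
        cong: if_cong intro!: sum.neutral)
  have neg: "trace (- M) = - trace M" for M :: "complex^'n^'n"
    by (simp add: trace_def sum_negf)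
  have tE: "trace (E i i) = 1" for i
    by (simp add: E_def trace_def)
  \<comment> \<open>At this pair of scaled matrix units the moment map is \<open>s\<close> times
    \<open>E a a - E b b\<close>, whose square has trace twice the square of \<open>s\<close>. A
    complex square root then reaches any value.\<close>
  have "casimir (s *\<^sub>m E a b, E b a) = 2 * s\<^sup>2" for s
    using ab
    by (simp add: casimir_def moment_def scale_mat_mult_left scale_mat_mult_right E matrix_diff_distrib
        trace_sub trace_scale_mat tE neg power2_eq_square)
  then have "casimir (csqrt (z / 2) *\<^sub>m E a b, E b a) = z" for z
    by simp
  then show ?thesis
    by (rule surjI)
qed

interpretation fun_space: vector_space "\<lambda>c (f :: 'a \<Rightarrow> complex) x. c * f x"
  by standard (simp_all add: fun_eq_iff algebra_simps)

text \<open>A linear relation among the powers of a surjective function is a polynomial vanishing at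
  every complex number, hence the zero polynomial. The powers thus form an infinite independent
  family.\<close>

lemma infinite_dimensional_powers:
  assumes "surj f" and "\<And>k. (\<lambda>x. f x ^ k) \<in> V"
  shows "infinite_dimensional V"
  unfolding infinite_dimensional_def
proof
  assume "\<exists>B. finite B \<and> V \<subseteq> module.span (\<lambda>c f x. c * f x) B"
  then obtain B where B: "finite B" "V \<subseteq> fun_space.span B" by blast
  have sum_apply: "sum g K x = (\<Sum>k\<in>K. g k x)" for g :: "nat \<Rightarrow> 'a \<Rightarrow> complex" and K x
    by (induction K rule: infinite_finite_induct) simp_all
  define P where "P k = (\<lambda>x. f x ^ k)" for k :: nat
  have coeff: "c k = 0" if "finite K" "(\<Sum>k\<in>K. (\<lambda>x. c k * P k x)) = 0" "k \<in> K" for K c k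
  proof -
    have "(\<Sum>k\<in>K. c k * z ^ k) = 0" for z
    proof -
      obtain x where "z = f x" using assms(1) by (metis surjD)
      then show ?thesis using fun_cong[OF that(2), of x] by (simp add: P_def sum_apply)
    qed
    then have "(\<Sum>k\<in>K. monom (c k) k) = 0"
      by (subst poly_all_0_iff_0[symmetric]) (simp add: poly_sum poly_monom)
    then have "coeff (\<Sum>k\<in>K. monom (c k) k) k = 0" by simp
    then show ?thesis using that by (simp add: coeff_sum)
  qed
  \<comment> \<open>Independence is a property of the set \<open>range P\<close>; injectivity turns
    relations on it into relations indexed by exponents, and makes the set infinite.\<close>
  have inj: "inj P"
  proof (rule injI, rule ccontr)
    fix k l assume kl: "P k = P l" "k \<noteq> l"
    \<comment> \<open>Two equal powers would give a relation with coefficients 1 and -1,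
      contradicting \<open>coeff\<close>.\<close>
    have "(\<lambda>m. if m = k then 1 else - 1 :: complex) k = 0"
      by (rule coeff[of "{k, l}"]) (use kl in \<open>simp_all add: fun_eq_iff\<close>)
    then show False by simp
  qed
  have "fun_space.independent (range P)"
    unfolding fun_space.independent_explicit_module
  proof (intro allI impI)
    fix T u v
    assume T: "finite T" "T \<subseteq> range P" "(\<Sum>v\<in>T. (\<lambda>x. u v * v x)) = 0" "v \<in> T"
    then obtain K where K: "T = P ` K" "finite K"
      by (metis finite_subset_image)
    have "(\<Sum>k\<in>K. (\<lambda>x. u (P k) * P k x)) = 0"
      using T(3) unfolding K(1) by (subst (asm) sum.reindex) (auto intro: inj_on_subset[OF inj])
    then show "u v = 0"
      using coeff[OF K(2)] T(4) K(1) by auto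
  qed
  \<comment> \<open>An independent set inside the span of the finite set \<open>B\<close> must
    itself be finite.\<close>
  then have "finite (range P)"
    using fun_space.independent_span_bound[OF B(1)] B(2) assms(2) by (auto simp: P_def)
  then show False
    using inj finite_imageD infinite_UNIV_nat by blast
qed

theorem corollary2:
  assumes "CARD('n::finite) \<ge> 2"
  shows "infinite_dimensional (PH0_iss :: ('n rep \<Rightarrow> complex) set)"
  using infinite_dimensional_powers[OF surj_casimir[OF assms] casimir_power_in_PH0] .

end
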